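(* Let $X,Y$ be two non-negative integer-valued random variables such that $X$ is stochastically larger than $Y$, and let $q$ be a positive integer. If $\mathbb{E}[X_q]\le\mathbb{E}[Y_{q+1}]$, then $\mathbb{E}[X_q^2]\le\mathbb{E}[Y_{q+1}^2]$.
   Context: For a non-negative integer-valued random variable $Z$ and a positive integer $n$, $Z_n$ denotes the truncated random variable $Z_n=\min(Z,n)$. $X$ is stochastically larger than $Y$ if $\mathbb{P}(X>t)\ge\mathbb{P}(Y>t)$ for all real $t$. *)

theory Defs
  imports "HOL-Probability.Probability"
begin

definition truncated :: "('a \<Rightarrow> nat) \<Rightarrow> nat \<Rightarrow> 'a \<Rightarrow> nat" where
  "truncated Z n = (\<lambda>\<omega>. min (Z \<omega>) n)"

(* Only the two laws are compared, so X and Y may live on different probability spaces. *)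
definition stochastically_larger ::
    "'a measure \<Rightarrow> ('a \<Rightarrow> real) \<Rightarrow> 'b measure \<Rightarrow> ('b \<Rightarrow> real) \<Rightarrow> bool" where
  "stochastically_larger M X N Y \<longleftrightarrow>
     (\<forall>t::real. measure M {\<omega> \<in> space M. X \<omega> > t} \<ge> measure N {\<omega> \<in> space N. Y \<omega> > t})"

end

theory Submission
  imports Defs
begin

text \<open>
  Write \<open>a k = P(X > k)\<close> and \<open>b k = P(Y > k)\<close>. Summation by parts over the levels crossed by a
  truncated variable gives
  \<open>E[Z_n] = (\<Sum>k<n. P(Z > k))\<close> and \<open>E[Z_n\<^sup>2] = (\<Sum>k<n. (2 k + 1) P(Z > k))\<close>
  (\<open>expectation_truncated\<close>), because \<open>(k + 1)\<^sup>2 - k\<^sup>2 = 2 k + 1\<close>.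
  Stochastic domination says that all excesses \<open>a k - b k\<close> are non-negative, and the
  hypothesis on the means says that the excesses below level \<open>q\<close> have total at most \<open>b q\<close>,
  the one extra term that truncating \<open>Y\<close> at \<open>q + 1\<close> contributes.
  In the second moments the weights \<open>2 k + 1\<close> increase with \<open>k\<close>, so the excesses are weighted
  less than the term \<open>b q\<close> that compensates for them, and the inequality of the means carries over.
\<close>

text \<open>
  The value \<open>f (min z n)\<close> is reached from \<open>f 0\<close> by collecting the increment \<open>f (k + 1) - f k\<close>
  at each level \<open>k < n\<close> with \<open>k < z\<close>. Expectation then commutes with this finite sum.
\<close>

lemma (in prob_space) expectation_truncated:
  fixes f :: "nat \<Rightarrow> real"
  assumes Z [measurable]: "Z \<in> M \<rightarrow>\<^sub>M count_space UNIV"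
  shows "(\<integral>\<omega>. f (truncated Z n \<omega>) \<partial>M)
    = f 0 + (\<Sum>k<n. (f (Suc k) - f k) * prob {\<omega> \<in> space M. k < Z \<omega>})"
proof -
  have telescope: "f (min z n) = f 0 + (\<Sum>k<n. (f (Suc k) - f k) * of_bool (k < z))" for z
    by (induction n) (auto simp: min_def not_le dest: le_antisym)
  define A where "A k = {\<omega> \<in> space M. k < Z \<omega>}" for k
  have [measurable]: "A k \<in> sets M" for k
    unfolding A_def by measurable
  have "(\<integral>\<omega>. f (truncated Z n \<omega>) \<partial>M)
      = (\<integral>\<omega>. f 0 + (\<Sum>k<n. (f (Suc k) - f k) * indicator (A k) \<omega>) \<partial>M)"
    by (intro Bochner_Integration.integral_cong refl)
       (simp add: truncated_def telescope A_def indicator_def)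
  also have "\<dots> = f 0 + (\<Sum>k<n. (f (Suc k) - f k) * prob (A k))"
    by (simp add: prob_space less_top[symmetric] del: sum_mult_indicator)
  finally show ?thesis
    by (simp only: A_def)
qed

text \<open>
  The weight \<open>w q\<close> of the compensating term dominates the weights of all the excesses
  \<open>a k - b k\<close>, so the unweighted inequality can be scaled by \<open>w q\<close>.
\<close>

lemma weighted_sum_le_of_sum_le:
  fixes a b w :: "nat \<Rightarrow> real"
  assumes dom: "\<And>k. k < q \<Longrightarrow> b k \<le> a k"
    and w: "\<And>k. k < q \<Longrightarrow> w k \<le> w q" "0 \<le> w q"
    and le: "(\<Sum>k<q. a k) \<le> (\<Sum>k<Suc q. b k)"
  shows "(\<Sum>k<q. w k * a k) \<le> (\<Sum>k<Suc q. w k * b k)"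
proof -
  have "(\<Sum>k<q. w k * (a k - b k)) \<le> (\<Sum>k<q. w q * (a k - b k))"
    by (intro sum_mono mult_right_mono) (auto simp: dom w)
  also have "\<dots> = w q * (\<Sum>k<q. a k - b k)"
    by (simp add: sum_distrib_left)
  also have "\<dots> \<le> w q * b q"
    using le by (intro mult_left_mono w) (simp add: sum_subtractf)
  finally show ?thesis
    by (simp add: right_diff_distrib sum_subtractf)
qed

theorem lemma4p3:
  fixes M :: "'a measure" and N :: "'b measure"
    and X :: "'a \<Rightarrow> nat" and Y :: "'b \<Rightarrow> nat" and q :: nat
  assumes "prob_space M" and "prob_space N"
    and "X \<in> M \<rightarrow>\<^sub>M count_space UNIV" and "Y \<in> N \<rightarrow>\<^sub>M count_space UNIV"
    and "stochastically_larger M (\<lambda>\<omega>. real (X \<omega>)) N (\<lambda>\<omega>. real (Y \<omega>))"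
    and "q > 0"
    and "(\<integral>\<omega>. real (truncated X q \<omega>) \<partial>M) \<le> (\<integral>\<omega>. real (truncated Y (q + 1) \<omega>) \<partial>N)"
  shows "(\<integral>\<omega>. (real (truncated X q \<omega>))\<^sup>2 \<partial>M) \<le> (\<integral>\<omega>. (real (truncated Y (q + 1) \<omega>))\<^sup>2 \<partial>N)"
proof -
  define a where "a k = measure M {\<omega> \<in> space M. k < X \<omega>}" for k
  define b where "b k = measure N {\<omega> \<in> space N. k < Y \<omega>}" for k
  note EX = prob_space.expectation_truncated[OF assms(1,3), folded a_def]
  note EY = prob_space.expectation_truncated[OF assms(2,4), folded b_def]
  have dom: "b k \<le> a k" for k
    using assms(5)[unfolded stochastically_larger_def, rule_format, of "real k"]
    by (simp add: a_def b_def)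
  have mean: "(\<Sum>k<q. a k) \<le> (\<Sum>k<Suc q. b k)"
    using assms(7) EX[of real q] EY[of real "q + 1"] by simp
  have weight: "(real (Suc k))\<^sup>2 - (real k)\<^sup>2 = 2 * real k + 1" for k
    by (simp add: power2_eq_square algebra_simps)
  have "(\<Sum>k<q. (2 * real k + 1) * a k) \<le> (\<Sum>k<Suc q. (2 * real k + 1) * b k)"
    by (rule weighted_sum_le_of_sum_le) (use dom mean in auto)
  then show ?thesis
    using EX[of "\<lambda>k. (real k)\<^sup>2" q, unfolded weight]
      EY[of "\<lambda>k. (real k)\<^sup>2" "q + 1", unfolded weight] by simp
qed

end
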